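(* Let $n\ge1$. For any $\gamma\in\mathbb{C}$ and $\tau\in\mathbb{R}$, the function $$\tilde\rho_\tau^\gamma(s,x,y)=\frac{e^{-\gamma s\tau/4}}{(2\pi)^n(\cosh(s\tau/2))^{n/2}(A^2+B^2)^{n/2}}\;e^{-\frac{A}{2(A^2+B^2)}(|x|^2+|y|^2)-i\frac{B}{A^2+B^2}\,x\cdot y},\qquad s>0,\ x,y\in\mathbb{R}^n,$$ where $$A=\frac{\sinh(s\tau/2)}{\tau\cosh(s\tau/2)},\qquad B=\frac{2\sinh^2(s\tau/4)}{\tau\cosh(s\tau/2)},$$ is the fundamental solution to the weighted $\bar\partial$ heat equation: $$\Big(\frac{\partial}{\partial s}+\tilde{\mathcal{L}}_\gamma\Big)\tilde\rho_\tau^\gamma(s,x,y)=0\quad(s>0),\qquad \tilde\rho_\tau^\gamma(s=0,x,y)=\delta_{(0,0)}(x,y).$$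
   Context: For $\gamma\in\mathbb{C}$ and $\tau\in\mathbb{R}$, $\tilde{\mathcal{L}}_\gamma$ is the differential operator on functions of $(x,y)\in\mathbb{R}^n\times\mathbb{R}^n$ given by $$\tilde{\mathcal{L}}_\gamma=-\frac14\Big(\triangle_{x,y}+2i\tau\,y\cdot\nabla_x-(\tau^2\,y\cdot y+\gamma\tau)\Big),$$ where $\triangle_{x,y}=\sum_{j=1}^n\big(\partial_{x_j}^2+\partial_{y_j}^2\big)$ is the Laplacian in both the $x$ and $y$ variables, $\nabla_x$ is the gradient in $x$, and $\cdot$ is the standard dot product. (It is the partial Fourier transform in $t$, with $\tilde f_\tau(x,y)=\int_{\mathbb{R}}e^{-i\tau t}f(x,y,t)\,dt$, of the operator $-\frac14\big(\sum_{j=1}^n[(\partial_{x_j}+y_j\partial_t)^2+\partial_{y_j}^2]+i\gamma\partial_t\big)$.) $\delta_{(0,0)}$ is the delta function at the origin of $\mathbb{R}^n\times\mathbb{R}^n$, and the initial condition means convergence as $s\to0^+$ in the sense of distributions. At $\tau=0$, $A$ and $B$ are interpreted by continuity, i.e. $A=s/2$ and $B=0$. *)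

theory Defs
  imports "HOL-Analysis.Analysis"
begin

definition dir_deriv :: "'a::real_normed_vector \<Rightarrow> ('a \<Rightarrow> complex) \<Rightarrow> 'a \<Rightarrow> complex" where
  "dir_deriv v f z = vector_derivative (\<lambda>h. f (z + h *\<^sub>R v)) (at 0)"

text \<open>
  \<open>Ck k f\<close>: all partial derivatives of order at most \<open>k\<close> exist and are continuous.
\<close>

primrec Ck :: "nat \<Rightarrow> ('a::euclidean_space \<Rightarrow> complex) \<Rightarrow> bool" where
  "Ck 0 f \<longleftrightarrow> continuous_on UNIV f"
| "Ck (Suc k) f \<longleftrightarrow> f differentiable_on UNIV \<and> (\<forall>b\<in>Basis. Ck k (dir_deriv b f))"

definition test_function :: "('a::euclidean_space \<Rightarrow> complex) \<Rightarrow> bool" where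
  "test_function \<phi> \<longleftrightarrow> (\<forall>k. Ck k \<phi>) \<and> compact (closure {z. \<phi> z \<noteq> 0})"

text \<open>
  Distributions are represented by the functionals they induce; only the values on test
  functions matter. \<open>regular_distr f\<close> is meaningful when \<open>f\<close> is locally integrable.
\<close>

definition locally_integrable :: "('a::euclidean_space \<Rightarrow> complex) \<Rightarrow> bool" where
  "locally_integrable f \<longleftrightarrow> (\<forall>K. compact K \<longrightarrow> set_integrable lborel K f)"

definition regular_distr ::
    "('a::euclidean_space \<Rightarrow> complex) \<Rightarrow> ('a \<Rightarrow> complex) \<Rightarrow> complex" where
  "regular_distr f = (\<lambda>\<phi>. LINT z|lborel. f z * \<phi> z)"

definition dirac_delta :: "'a::euclidean_space \<Rightarrow> ('a \<Rightarrow> complex) \<Rightarrow> complex" where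
  "dirac_delta a = (\<lambda>\<phi>. \<phi> a)"

definition tendsto_distr ::
    "('b \<Rightarrow> ('a::euclidean_space \<Rightarrow> complex) \<Rightarrow> complex) \<Rightarrow>
     (('a \<Rightarrow> complex) \<Rightarrow> complex) \<Rightarrow> 'b filter \<Rightarrow> bool" where
  "tendsto_distr T T0 F \<longleftrightarrow> (\<forall>\<phi>. test_function \<phi> \<longrightarrow> ((\<lambda>s. T s \<phi>) \<longlongrightarrow> T0 \<phi>) F)"

text \<open>
  Points of \<open>\<real>\<^sup>n \<times> \<real>\<^sup>n\<close> are pairs \<open>(x, y)\<close> with \<open>x y :: real ^ 'n\<close> and \<open>n = CARD('n)\<close>.
\<close>

definition dx :: "'n::finite \<Rightarrow> ((real ^ 'n) \<times> (real ^ 'n) \<Rightarrow> complex) \<Rightarrow>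
    (real ^ 'n) \<times> (real ^ 'n) \<Rightarrow> complex" where
  "dx j = dir_deriv (axis j 1, 0)"

definition dy :: "'n::finite \<Rightarrow> ((real ^ 'n) \<times> (real ^ 'n) \<Rightarrow> complex) \<Rightarrow>
    (real ^ 'n) \<times> (real ^ 'n) \<Rightarrow> complex" where
  "dy j = dir_deriv (0, axis j 1)"

definition laplacian_xy :: "((real ^ 'n::finite) \<times> (real ^ 'n) \<Rightarrow> complex) \<Rightarrow>
    (real ^ 'n) \<times> (real ^ 'n) \<Rightarrow> complex" where
  "laplacian_xy f z = (\<Sum>j\<in>UNIV. dx j (dx j f) z + dy j (dy j f) z)"

definition L_op :: "complex \<Rightarrow> real \<Rightarrow> ((real ^ 'n::finite) \<times> (real ^ 'n) \<Rightarrow> complex) \<Rightarrow>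
    (real ^ 'n) \<times> (real ^ 'n) \<Rightarrow> complex" where
  "L_op \<gamma> \<tau> f = (\<lambda>(x, y).
     - (1 / 4) * (laplacian_xy f (x, y)
       + 2 * \<i> * complex_of_real \<tau> * (\<Sum>j\<in>UNIV. complex_of_real (y $ j) * dx j f (x, y))
       - (complex_of_real (\<tau>\<^sup>2 * (y \<bullet> y)) + \<gamma> * complex_of_real \<tau>) * f (x, y)))"

text \<open>
  Fundamental solution (with pole at the origin) of \<open>\<partial>u/\<partial>s + L u = 0\<close> for a second-order
  operator \<open>L\<close>: a classical solution for \<open>s > 0\<close> whose initial value is the delta function at 0
  in the sense of distributions. The regularity clauses make the derivatives in the equation
  genuine, since \<open>vector_derivative\<close> is total.
\<close>

definition fundamental_solution ::
    "(('a::euclidean_space \<Rightarrow> complex) \<Rightarrow> 'a \<Rightarrow> complex) \<Rightarrow> (real \<Rightarrow> 'a \<Rightarrow> complex) \<Rightarrow> bool" where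
  "fundamental_solution L u \<longleftrightarrow>
     (\<forall>s>0. Ck 2 (u s)) \<and>
     (\<forall>s>0. \<forall>z. (\<lambda>r. u r z) differentiable (at s)) \<and>
     (\<forall>s>0. \<forall>z. vector_derivative (\<lambda>r. u r z) (at s) + L (u s) z = 0) \<and>
     (\<forall>s>0. locally_integrable (u s)) \<and>
     tendsto_distr (\<lambda>s. regular_distr (u s)) (dirac_delta 0) (at_right 0)"

text \<open>The values at \<open>\<tau> = 0\<close> are the limits as \<open>\<tau> \<rightarrow> 0\<close>.\<close>

definition A_coef :: "real \<Rightarrow> real \<Rightarrow> real" where
  "A_coef \<tau> s = (if \<tau> = 0 then s / 2 else sinh (s * \<tau> / 2) / (\<tau> * cosh (s * \<tau> / 2)))"

definition B_coef :: "real \<Rightarrow> real \<Rightarrow> real" where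
  "B_coef \<tau> s = (if \<tau> = 0 then 0 else 2 * (sinh (s * \<tau> / 4))\<^sup>2 / (\<tau> * cosh (s * \<tau> / 2)))"

definition rho :: "complex \<Rightarrow> real \<Rightarrow> real \<Rightarrow> (real ^ 'n::finite) \<times> (real ^ 'n) \<Rightarrow> complex" where
  "rho \<gamma> \<tau> s = (\<lambda>(x, y).
     let A = A_coef \<tau> s; B = B_coef \<tau> s; n = CARD('n) in
       exp (- \<gamma> * complex_of_real (s * \<tau>) / 4)
       / complex_of_real ((2 * pi) ^ n * cosh (s * \<tau> / 2) powr (real n / 2)
           * (A\<^sup>2 + B\<^sup>2) powr (real n / 2))
       * exp (- complex_of_real (A / (2 * (A\<^sup>2 + B\<^sup>2)) * ((norm x)\<^sup>2 + (norm y)\<^sup>2))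
              - \<i> * complex_of_real (B / (A\<^sup>2 + B\<^sup>2) * (x \<bullet> y))))"

end

theory Submission
  imports Defs "HOL-Probability.Distributions"
begin

text \<open>
  Write \<open>g = 4 sinh (s \<tau> / 4) / \<tau>\<close> (and \<open>g = s\<close> for \<open>\<tau> = 0\<close>) and \<open>h = cosh (s \<tau> / 4)\<close>. Half-angle
  formulas give \<open>cosh (s \<tau> / 2) (A\<^sup>2 + B\<^sup>2) = g\<^sup>2 / 4\<close>, \<open>A / (2 (A\<^sup>2 + B\<^sup>2)) = h / g\<close> and
  \<open>B / (A\<^sup>2 + B\<^sup>2) = \<tau> / 2\<close>, so for \<open>s > 0\<close> the kernel has the Mehler form
  \<open>exp (- \<gamma> s \<tau> / 4) / (\<pi> g)\<^sup>n * exp (- (h / g) (|x|\<^sup>2 + |y|\<^sup>2) - \<i> (\<tau> / 2) x \<bullet> y)\<close>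
  (\<open>coefs_closed_form\<close>, \<open>rho_closed_form\<close>). The phase no longer depends on time, and apart
  from the first exponential time enters only through \<open>g\<close> and \<open>h\<close>, which satisfy \<open>g' = h\<close>,
  \<open>h' = (\<tau>\<^sup>2 / 16) g\<close>, \<open>h\<^sup>2 - (\<tau>\<^sup>2 / 16) g\<^sup>2 = 1\<close>
  for every \<open>\<tau>\<close>, including 0.

  The heat equation: the kernel is the exponential of a complex quadratic form, and the operator
  multiplies such a function by a quadratic polynomial (\<open>L_op_gaussian\<close>). With the phase coefficient
  \<open>\<tau> / 2\<close> the mixed terms \<open>x\<^sub>j y\<^sub>j\<close> cancel, and the potential \<open>\<tau>\<^sup>2 |y|\<^sup>2\<close> is traded for a
  rotation-invariant one; what remains is the Riccati equation \<open>a' = \<tau>\<^sup>2 / 16 - a\<^sup>2\<close> for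
  \<open>a = h / g\<close> and the transport equation \<open>C' = - (\<gamma> \<tau> / 4 + n a) C\<close> for the prefactor \<open>C\<close>
  (\<open>rho_time_deriv\<close>).

  The initial value: the phase is independent of \<open>s\<close>, continuous, and 1 at the origin, so it can be
  absorbed into the test function. What is left is a Gaussian of width \<open>sqrt (g / h)\<close>, which tends
  to 0, and of total mass \<open>exp (- \<gamma> s \<tau> / 4) / h\<^sup>n\<close>, which tends to 1; dominated convergence finishes the
  argument (\<open>gaussian_mean_tendsto\<close>, \<open>rho_tendsto_delta\<close>).
\<close>

section \<open>Gaussian approximate identities\<close>

text \<open>The Gaussian is the product over an orthonormal basis of one-dimensional ones.\<close>

lemma gaussian_euclidean:
  "integrable lborel (\<lambda>x::'a::euclidean_space. exp (- (norm x)\<^sup>2))"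
  "(LINT x::'a|lborel. exp (- (norm x)\<^sup>2)) = sqrt pi ^ DIM('a)"
proof -
  have "has_bochner_integral lborel (\<lambda>x::real. exp (- x\<^sup>2)) (sqrt pi)"
    using has_bochner_integral_even_function[OF gaussian_moment_0] by simp
  then have one_dim: "(\<integral>\<^sup>+x. ennreal (exp (- x\<^sup>2)) \<partial>lborel) = ennreal (sqrt pi)"
    by (subst nn_integral_eq_integral) (auto simp: has_bochner_integral_iff)
  have "(norm x)\<^sup>2 = (\<Sum>b\<in>Basis. (x \<bullet> b)\<^sup>2)" for x :: 'a
    unfolding power2_norm_eq_inner by (subst euclidean_inner) (simp add: power2_eq_square)
  then have "exp (- (norm x)\<^sup>2) = (\<Prod>b\<in>Basis. exp (- (x \<bullet> b)\<^sup>2))" for x :: 'a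
    by (simp only: sum_negf[symmetric] exp_sum finite_Basis)
  then have factor: "ennreal (exp (- (norm x)\<^sup>2)) = (\<Prod>b\<in>Basis. ennreal (exp (- (x \<bullet> b)\<^sup>2)))" for x :: 'a
    by (simp only: prod_ennreal exp_ge_zero)
  have "(\<integral>\<^sup>+(x::'a). ennreal (exp (- (norm x)\<^sup>2)) \<partial>lborel)
      = (\<Prod>b\<in>(Basis :: 'a set). (\<integral>\<^sup>+x. ennreal (exp (- x\<^sup>2)) \<partial>lborel))"
    unfolding factor by (rule nn_integral_lborel_prod) auto
  also have "\<dots> = ennreal (sqrt pi ^ DIM('a))"
    by (simp add: one_dim ennreal_power)
  finally have "has_bochner_integral lborel (\<lambda>x::'a. exp (- (norm x)\<^sup>2)) (sqrt pi ^ DIM('a))"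
    by (intro has_bochner_integral_nn_integral) auto
  then show "integrable lborel (\<lambda>x::'a. exp (- (norm x)\<^sup>2))"
    "(LINT x::'a|lborel. exp (- (norm x)\<^sup>2)) = sqrt pi ^ DIM('a)"
    by (auto simp: has_bochner_integral_iff)
qed

text \<open>
  Dominated convergence, with a multiple of the Gaussian as majorant. The width \<open>c\<close> may have
  either sign, so that the statement is continuity at \<open>c = 0\<close> and reduces to sequences.
\<close>

lemma gaussian_mean_tendsto:
  fixes f :: "'a::euclidean_space \<Rightarrow> complex"
  assumes cont: "continuous_on UNIV f" and bdd: "\<And>x. norm (f x) \<le> M"
  shows "((\<lambda>c. LINT w|lborel. complex_of_real (exp (- (norm w)\<^sup>2)) * f (c *\<^sub>R w))
           \<longlongrightarrow> complex_of_real (sqrt pi ^ DIM('a)) * f 0) (at 0)"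
proof -
  let ?G = "\<lambda>c. LINT w|lborel. complex_of_real (exp (- (norm w)\<^sup>2)) * f (c *\<^sub>R w)"
  have [measurable]: "f \<in> borel_measurable borel"
    using cont by (rule borel_measurable_continuous_onI)
  have G0: "?G 0 = complex_of_real (sqrt pi ^ DIM('a)) * f 0"
    by (simp add: gaussian_euclidean)
  have "isCont ?G 0"
    unfolding continuous_at_sequentially comp_def
  proof (intro allI impI)
    fix c :: "nat \<Rightarrow> real"
    assume c: "c \<longlonglongrightarrow> 0"
    show "(\<lambda>k. ?G (c k)) \<longlonglongrightarrow> ?G 0"
    proof (rule integral_dominated_convergence[where w = "\<lambda>w. exp (- (norm w)\<^sup>2) * M"])
      show "integrable lborel (\<lambda>w::'a. exp (- (norm w)\<^sup>2) * M)"
        by (intro integrable_mult_left gaussian_euclidean(1))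
      show "AE w in lborel. (\<lambda>k. complex_of_real (exp (- (norm w)\<^sup>2)) * f (c k *\<^sub>R w))
              \<longlonglongrightarrow> complex_of_real (exp (- (norm w)\<^sup>2)) * f (0 *\<^sub>R w)"
      proof (rule AE_I2)
        fix w :: 'a
        have "(\<lambda>k. c k *\<^sub>R w) \<longlonglongrightarrow> 0 *\<^sub>R w"
          by (intro tendsto_intros c)
        moreover have "isCont f (0 *\<^sub>R w)"
          using cont by (simp add: continuous_on_eq_continuous_at)
        ultimately have "(\<lambda>k. f (c k *\<^sub>R w)) \<longlonglongrightarrow> f (0 *\<^sub>R w)"
          using isCont_tendsto_compose by blast
        then show "(\<lambda>k. complex_of_real (exp (- (norm w)\<^sup>2)) * f (c k *\<^sub>R w))
              \<longlonglongrightarrow> complex_of_real (exp (- (norm w)\<^sup>2)) * f (0 *\<^sub>R w)"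
          by (intro tendsto_intros)
      qed
      show "AE w in lborel. norm (complex_of_real (exp (- (norm w)\<^sup>2)) * f (c k *\<^sub>R w))
              \<le> exp (- (norm w)\<^sup>2) * M" for k
        by (simp add: norm_mult bdd)
    qed auto
  qed
  then show ?thesis
    unfolding isCont_def G0 .
qed

lemma gaussian_integral_rescale:
  fixes f :: "'a::euclidean_space \<Rightarrow> complex"
  assumes [measurable]: "f \<in> borel_measurable borel" and c: "c > 0"
  shows "(LINT z|lborel. complex_of_real (exp (- (norm z)\<^sup>2 / c\<^sup>2)) * f z)
    = complex_of_real (c ^ DIM('a)) * (LINT w|lborel. complex_of_real (exp (- (norm w)\<^sup>2)) * f (c *\<^sub>R w))"
proof -
  have "(LINT z|lborel. complex_of_real (exp (- (norm z)\<^sup>2 / c\<^sup>2)) * f z)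
     = (LINT z|density (distr lborel borel (\<lambda>x::'a. 0 + c *\<^sub>R x)) (\<lambda>_. ennreal (\<bar>c\<bar> ^ DIM('a))).
          complex_of_real (exp (- (norm z)\<^sup>2 / c\<^sup>2)) * f z)"
    using c by (subst lborel_affine[of c 0]) auto
  also have "\<dots> = (LINT w|lborel. complex_of_real (c ^ DIM('a)) * 
      (complex_of_real (exp (- (norm (c *\<^sub>R w))\<^sup>2 / c\<^sup>2)) * f (c *\<^sub>R w)))"
    using c by (simp add: integral_density integral_distr scaleR_conv_of_real)
  also have "\<dots> = complex_of_real (c ^ DIM('a)) * 
      (LINT w|lborel. complex_of_real (exp (- (norm w)\<^sup>2)) * f (c *\<^sub>R w))"
    using c by (simp add: power_mult_distrib)
  finally show ?thesis .
qed

section \<open>Exponentials of quadratic forms\<close>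

lemma dir_deriv_eq:
  assumes "(f has_derivative f') (at z)"
  shows "dir_deriv v f z = f' v"
proof -
  have "((\<lambda>h::real. z + h *\<^sub>R v) has_derivative (\<lambda>h. h *\<^sub>R v)) (at 0)"
    by (auto intro!: derivative_eq_intros)
  then have "((\<lambda>h. f (z + h *\<^sub>R v)) has_derivative (\<lambda>h. f' (h *\<^sub>R v))) (at 0)"
    using has_derivative_compose[of "\<lambda>h::real. z + h *\<^sub>R v" _ 0 UNIV f f'] assms by simp
  moreover have "f' (h *\<^sub>R v) = h *\<^sub>R f' v" for h
    using assms by (simp add: has_derivative_def bounded_linear.linear linear_scale)
  ultimately show ?thesis
    unfolding dir_deriv_def by (intro vector_derivative_at) (simp add: has_vector_derivative_def)
qed

text \<open>
  Each derivative of \<open>exp (M z z / 2)\<close> in a direction \<open>v\<close> brings down the linear factor \<open>M v z\<close>,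
  because the symmetry of \<open>M\<close> cancels the factor 1/2. The action of
  the differential operator and the regularity of the kernel are both read off from this.
\<close>

context
  fixes M :: "'a::euclidean_space \<Rightarrow> 'a \<Rightarrow> complex" and C :: complex
  assumes bil: "bounded_bilinear M" and sym: "\<And>v w. M v w = M w v"
begin

lemma exp_quadratic_has_derivative:
  "((\<lambda>z. C * exp (M z z / 2)) has_derivative (\<lambda>v. M v z * (C * exp (M z z / 2)))) (at z)"
proof -
  have "((\<lambda>z. M z z) has_derivative (\<lambda>v. 2 * M v z)) (at z)"
    using bounded_bilinear.FDERIV[OF bil has_derivative_ident has_derivative_ident, of z UNIV]
    by (simp add: sym[of z])
  then have "((\<lambda>z. M z z / 2) has_derivative (\<lambda>v. M v z)) (at z)"
    using has_derivative_mult_left[of _ _ _ "1 / 2"] by force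
  moreover have "(exp has_derivative (\<lambda>w. exp (M z z / 2) * w)) (at (M z z / 2))"
    using DERIV_exp has_field_derivative_def by blast
  ultimately have "((\<lambda>z. exp (M z z / 2)) has_derivative (\<lambda>v. exp (M z z / 2) * M v z)) (at z)"
    by (rule has_derivative_compose)
  from has_derivative_mult_right[OF this, of C] show ?thesis
    by (simp add: mult_ac)
qed

lemma exp_quadratic_linear_has_derivative:
  "((\<lambda>z. M v z * (C * exp (M z z / 2))) has_derivative
     (\<lambda>w. (M v w + M v z * M w z) * (C * exp (M z z / 2)))) (at z)"
proof -
  have "((\<lambda>z. M v z) has_derivative M v) (at z)"
    by (rule bounded_linear_imp_has_derivative[OF bounded_bilinear.bounded_linear_right[OF bil]])
  then show ?thesis
    by (rule has_derivative_eq_rhs[OF has_derivative_mult[OF _ exp_quadratic_has_derivative]])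
      (auto simp: algebra_simps)
qed

lemma dir_deriv_exp_quadratic:
  "dir_deriv v (\<lambda>z. C * exp (M z z / 2)) = (\<lambda>z. M v z * (C * exp (M z z / 2)))"
  by (intro ext dir_deriv_eq exp_quadratic_has_derivative)

lemma dir_deriv2_exp_quadratic:
  "dir_deriv w (dir_deriv v (\<lambda>z. C * exp (M z z / 2))) =
     (\<lambda>z. (M v w + M v z * M w z) * (C * exp (M z z / 2)))"
  unfolding dir_deriv_exp_quadratic
  by (intro ext dir_deriv_eq exp_quadratic_linear_has_derivative)

lemma Ck_2_exp_quadratic: "Ck 2 (\<lambda>z. C * exp (M z z / 2))"
proof -
  have "continuous_on UNIV (\<lambda>z. (M v w + M v z * M w z) * (C * exp (M z z / 2)))" for v w
    by (intro continuous_intros bounded_bilinear.continuous_on[OF bil]) auto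
  moreover have "(\<lambda>z. C * exp (M z z / 2)) differentiable_on UNIV"
    using exp_quadratic_has_derivative by (force simp: differentiable_on_def differentiable_def)
  moreover have "dir_deriv v (\<lambda>z. C * exp (M z z / 2)) differentiable_on UNIV" for v
    using exp_quadratic_linear_has_derivative
    by (force simp: differentiable_on_def differentiable_def dir_deriv_exp_quadratic)
  ultimately show ?thesis
    by (simp add: numeral_2_eq_2 dir_deriv2_exp_quadratic)
qed

end

section \<open>Closed form of the kernel\<close>

text \<open>
  For each \<open>\<tau>\<close> the pair \<open>(mehler_g \<tau>, mehler_h \<tau>)\<close> is the solution of \<open>g' = h\<close>,
  \<open>h' = (\<tau>\<^sup>2 / 16) g\<close> with \<open>g 0 = 0\<close> and \<open>h 0 = 1\<close>. This system depends polynomially on \<open>\<tau>\<close>, so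
  reasoning from it removes the case distinction on \<open>\<tau> = 0\<close>.
\<close>

definition mehler_g :: "real \<Rightarrow> real \<Rightarrow> real" where
  "mehler_g \<tau> s = (if \<tau> = 0 then s else 4 * sinh (s * \<tau> / 4) / \<tau>)"

definition mehler_h :: "real \<Rightarrow> real \<Rightarrow> real" where
  "mehler_h \<tau> s = cosh (s * \<tau> / 4)"

lemma mehler_sinh: "sinh (s * \<tau> / 4) = \<tau> / 4 * mehler_g \<tau> s"
  by (simp add: mehler_g_def)

lemma mehler_g_pos: "s > 0 \<Longrightarrow> mehler_g \<tau> s > 0"
  by (cases \<tau> "0::real" rule: linorder_cases)
    (auto simp: mehler_g_def zero_less_divide_iff mult_less_0_iff)

lemma mehler_h_pos: "mehler_h \<tau> s > 0"
  by (simp add: mehler_h_def)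

lemma mehler_pythagoras: "(mehler_h \<tau> s)\<^sup>2 = 1 + \<tau>\<^sup>2 / 16 * (mehler_g \<tau> s)\<^sup>2"
proof -
  have "(mehler_h \<tau> s)\<^sup>2 = 1 + (sinh (s * \<tau> / 4))\<^sup>2"
    by (simp add: mehler_h_def cosh_square_eq)
  then show ?thesis
    by (simp add: mehler_sinh power_mult_distrib power_divide)
qed

lemma mehler_g_deriv: "(mehler_g \<tau> has_real_derivative mehler_h \<tau> s) (at s)"
proof (cases "\<tau> = 0")
  case True
  then show ?thesis
    by (simp add: mehler_g_def[abs_def] mehler_h_def)
next
  case False
  then show ?thesis
    by (auto simp: mehler_g_def[abs_def] mehler_h_def intro!: derivative_eq_intros)
qed

lemma mehler_h_deriv: "(mehler_h \<tau> has_real_derivative \<tau>\<^sup>2 / 16 * mehler_g \<tau> s) (at s)"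
proof -
  have "((\<lambda>s. cosh (s * \<tau> / 4)) has_real_derivative sinh (s * \<tau> / 4) * (\<tau> / 4)) (at s)"
    by (auto intro!: derivative_eq_intros)
  then show ?thesis
    unfolding mehler_sinh by (simp add: mehler_h_def[abs_def] power2_eq_square mult_ac)
qed

text \<open>
  By the conserved quantity the numerator of the quotient rule is constant; together with
  \<open>1 / g\<^sup>2 = (h / g)\<^sup>2 - \<tau>\<^sup>2 / 16\<close> this is the Riccati equation for \<open>h / g\<close>.
\<close>

lemma mehler_width_deriv:
  assumes "s > 0"
  shows "((\<lambda>r. mehler_h \<tau> r / mehler_g \<tau> r) has_real_derivative - (1 / (mehler_g \<tau> s)\<^sup>2)) (at s)"
proof -
  have g: "mehler_g \<tau> s \<noteq> 0"
    using mehler_g_pos[OF assms, of \<tau>] by simp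
  have "((\<lambda>r. mehler_h \<tau> r / mehler_g \<tau> r) has_real_derivative
     (\<tau>\<^sup>2 / 16 * mehler_g \<tau> s * mehler_g \<tau> s - mehler_h \<tau> s * mehler_h \<tau> s)
       / (mehler_g \<tau> s * mehler_g \<tau> s)) (at s)"
    by (rule DERIV_divide[OF mehler_h_deriv mehler_g_deriv g])
  moreover have "\<tau>\<^sup>2 / 16 * mehler_g \<tau> s * mehler_g \<tau> s - mehler_h \<tau> s * mehler_h \<tau> s = -1"
    using mehler_pythagoras[of \<tau> s] by (simp add: power2_eq_square)
  ultimately show ?thesis
    by (simp add: power2_eq_square)
qed

text \<open>
  With \<open>c = cosh (s \<tau> / 2) = h\<^sup>2 + (\<tau>\<^sup>2 / 16) g\<^sup>2\<close> the double-angle formulas turn the coefficients into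
  \<open>A = g h / (2 c)\<close> and \<open>B = \<tau> g\<^sup>2 / (8 c)\<close>. Hence \<open>A\<^sup>2 + B\<^sup>2 = g\<^sup>2 / (4 c\<^sup>2) * c\<close>, where one factor \<open>c\<close>
  cancels, and all three identities follow.
\<close>

lemma coefs_closed_form:
  fixes \<tau> s :: real
  assumes "s > 0"
  defines "g \<equiv> mehler_g \<tau> s" and "h \<equiv> mehler_h \<tau> s"
  shows "cosh (s * \<tau> / 2) * ((A_coef \<tau> s)\<^sup>2 + (B_coef \<tau> s)\<^sup>2) = (g / 2)\<^sup>2"
    and "A_coef \<tau> s / (2 * ((A_coef \<tau> s)\<^sup>2 + (B_coef \<tau> s)\<^sup>2)) = h / g"
    and "B_coef \<tau> s / ((A_coef \<tau> s)\<^sup>2 + (B_coef \<tau> s)\<^sup>2) = \<tau> / 2"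
proof -
  define c where "c = cosh (s * \<tau> / 2)"
  have c0: "c > 0" and g0: "g > 0"
    using assms mehler_g_pos by (auto simp: c_def)
  have double: "s * \<tau> / 2 = 2 * (s * \<tau> / 4)"
    by simp
  have c_eq: "c = h\<^sup>2 + \<tau>\<^sup>2 / 16 * g\<^sup>2"
    unfolding c_def double cosh_double mehler_sinh g_def h_def mehler_h_def
    by (simp add: power_mult_distrib power_divide)
  have sinh_eq: "sinh (s * \<tau> / 2) = \<tau> / 2 * g * h"
    unfolding double sinh_double mehler_sinh g_def h_def mehler_h_def by simp
  have A: "A_coef \<tau> s = g * h / (2 * c)"
    unfolding A_coef_def sinh_eq c_def[symmetric]
    by (auto simp: c_def g_def h_def mehler_g_def mehler_h_def)
  have B: "B_coef \<tau> s = \<tau> * g\<^sup>2 / (8 * c)"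
    unfolding B_coef_def mehler_sinh c_def[symmetric] g_def[symmetric]
    using c0 by (simp add: field_simps power2_eq_square)
  have "(A_coef \<tau> s)\<^sup>2 + (B_coef \<tau> s)\<^sup>2 = g\<^sup>2 / (4 * c\<^sup>2) * (h\<^sup>2 + \<tau>\<^sup>2 / 16 * g\<^sup>2)"
    unfolding A B using c0 by (simp add: field_simps power2_eq_square)
  also have "\<dots> = g\<^sup>2 / (4 * c)"
    unfolding c_eq[symmetric] using c0 by (simp add: power2_eq_square)
  finally have AB: "(A_coef \<tau> s)\<^sup>2 + (B_coef \<tau> s)\<^sup>2 = g\<^sup>2 / (4 * c)" .
  show "cosh (s * \<tau> / 2) * ((A_coef \<tau> s)\<^sup>2 + (B_coef \<tau> s)\<^sup>2) = (g / 2)\<^sup>2"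
    unfolding AB c_def[symmetric] using c0 by (simp add: power_divide)
  show "A_coef \<tau> s / (2 * ((A_coef \<tau> s)\<^sup>2 + (B_coef \<tau> s)\<^sup>2)) = h / g"
    unfolding AB unfolding A using c0 g0 by (simp add: field_simps power2_eq_square)
  show "B_coef \<tau> s / ((A_coef \<tau> s)\<^sup>2 + (B_coef \<tau> s)\<^sup>2) = \<tau> / 2"
    unfolding AB unfolding B using c0 g0 by (simp add: field_simps power2_eq_square)
qed

text \<open>
  The symmetric bilinear form whose diagonal is twice the exponent
  \<open>- a (|x|\<^sup>2 + |y|\<^sup>2) - \<i> b (x \<bullet> y)\<close> at \<open>z = (x, y)\<close>.
\<close>

definition gauss_form :: "real \<Rightarrow> real \<Rightarrow> 'a \<times> 'a \<Rightarrow> 'a::euclidean_space \<times> 'a \<Rightarrow> complex" where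
  "gauss_form a b v z =
     - complex_of_real (2 * a * (v \<bullet> z))
     - \<i> * complex_of_real (b * (fst v \<bullet> snd z + snd v \<bullet> fst z))"

lemma bounded_bilinear_gauss_form: "bounded_bilinear (gauss_form a b)"
proof -
  have "bilinear (gauss_form a b)"
    unfolding bilinear_def
    by (auto intro!: linearI simp: gauss_form_def inner_add_left inner_add_right
        algebra_simps scaleR_conv_of_real)
  then show ?thesis
    by (simp add: bilinear_conv_bounded_bilinear)
qed

lemma gauss_form_commute: "gauss_form a b v w = gauss_form a b w v"
  by (simp add: gauss_form_def inner_commute add.commute)

lemma gauss_form_diag:
  "gauss_form a b (x, y) (x, y) / 2 =
     - complex_of_real (a * ((norm x)\<^sup>2 + (norm y)\<^sup>2)) - \<i> * complex_of_real (b * (x \<bullet> y))"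
  by (simp add: gauss_form_def power2_norm_eq_inner inner_commute[of y x] field_simps)

definition mehler_const :: "complex \<Rightarrow> real \<Rightarrow> nat \<Rightarrow> real \<Rightarrow> complex" where
  "mehler_const \<gamma> \<tau> n s =
     exp (- \<gamma> * complex_of_real (s * \<tau>) / 4) / complex_of_real ((pi * mehler_g \<tau> s) ^ n)"

text \<open>
  The two real powers combine: \<open>((g / 2)\<^sup>2) powr (n / 2)\<close> is the natural power \<open>(g / 2)\<^sup>n\<close> since
  \<open>g > 0\<close>.
\<close>

lemma rho_closed_form:
  assumes "s > 0"
  shows "(rho \<gamma> \<tau> s :: (real ^ 'n::finite) \<times> (real ^ 'n) \<Rightarrow> complex) =
    (\<lambda>z. mehler_const \<gamma> \<tau> CARD('n) s *
       exp (gauss_form (mehler_h \<tau> s / mehler_g \<tau> s) (\<tau> / 2) z z / 2))"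
proof (rule ext, clarify)
  fix x y :: "real ^ 'n"
  define D where "D = (A_coef \<tau> s)\<^sup>2 + (B_coef \<tau> s)\<^sup>2"
  note cf = coefs_closed_form[OF assms, of \<tau>, folded D_def]
  have g: "mehler_g \<tau> s > 0"
    using assms by (rule mehler_g_pos)
  have "cosh (s * \<tau> / 2) powr (CARD('n) / 2) * D powr (CARD('n) / 2)
      = ((mehler_g \<tau> s / 2)\<^sup>2) powr (CARD('n) / 2)"
    unfolding powr_mult[symmetric] cf ..
  also have "\<dots> = (mehler_g \<tau> s / 2) powr (2 * (CARD('n) / 2))"
    using g by (subst powr_powr[symmetric]) simp
  also have "\<dots> = (mehler_g \<tau> s / 2) ^ CARD('n)"
    using g by (simp add: powr_realpow)
  finally have "(2 * pi) ^ CARD('n) * cosh (s * \<tau> / 2) powr (CARD('n) / 2) * D powr (CARD('n) / 2)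
      = (pi * mehler_g \<tau> s) ^ CARD('n)"
    by (simp only: mult.assoc power_mult_distrib[symmetric]) simp
  then show "rho \<gamma> \<tau> s (x, y) = mehler_const \<gamma> \<tau> CARD('n) s *
       exp (gauss_form (mehler_h \<tau> s / mehler_g \<tau> s) (\<tau> / 2) (x, y) (x, y) / 2)"
    unfolding rho_def Let_def case_prod_conv gauss_form_diag mehler_const_def D_def[symmetric] cf
    by simp
qed

section \<open>The heat equation\<close>

text \<open>
  The phase coefficient is taken to be exactly \<open>\<tau> / 2\<close>. In each coordinate the second derivatives
  then contribute the mixed term \<open>4 \<i> \<tau> a x\<^sub>j y\<^sub>j\<close> and \<open>- (\<tau>\<^sup>2 / 4) (x\<^sub>j\<^sup>2 + y\<^sub>j\<^sup>2)\<close>, while the drift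
  \<open>2 \<i> \<tau> y\<^sub>j \<partial>\<^sub>x\<^sub>j\<close> contributes \<open>- 4 \<i> \<tau> a x\<^sub>j y\<^sub>j + \<tau>\<^sup>2 y\<^sub>j\<^sup>2\<close>: the mixed terms cancel, and so does
  the potential \<open>\<tau>\<^sup>2 y\<^sub>j\<^sup>2\<close>.
\<close>

lemma L_op_gaussian:
  fixes C \<gamma> :: complex and a \<tau> :: real and x y :: "real ^ 'n::finite"
  defines "u \<equiv> (\<lambda>z. C * exp (gauss_form a (\<tau> / 2) z z / 2))"
  shows "L_op \<gamma> \<tau> u (x, y) =
    (\<gamma> * complex_of_real \<tau> / 4 + complex_of_real (real CARD('n) * a)
      - complex_of_real ((a\<^sup>2 - \<tau>\<^sup>2 / 16) * ((norm x)\<^sup>2 + (norm y)\<^sup>2))) * u (x, y)"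
proof -
  note bil = bounded_bilinear_gauss_form[of a "\<tau> / 2"]
  have d1: "dir_deriv v u = (\<lambda>z. gauss_form a (\<tau> / 2) v z * u z)" for v
    unfolding u_def by (rule dir_deriv_exp_quadratic[OF bil gauss_form_commute])
  have d2: "dir_deriv w (dir_deriv v u) = (\<lambda>z. (gauss_form a (\<tau> / 2) v w
      + gauss_form a (\<tau> / 2) v z * gauss_form a (\<tau> / 2) w z) * u z)" for v w
    unfolding u_def by (rule dir_deriv2_exp_quadratic[OF bil gauss_form_commute])
  have dx: "dx j u (x, y) = (- complex_of_real (2 * a * x $ j)
      - \<i> * complex_of_real (\<tau> / 2 * y $ j)) * u (x, y)" for j
    unfolding dx_def d1 by (simp add: gauss_form_def inner_axis')
  have dxx: "dx j (dx j u) (x, y) = (- complex_of_real (2 * a) + (- complex_of_real (2 * a * x $ j)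
      - \<i> * complex_of_real (\<tau> / 2 * y $ j))\<^sup>2) * u (x, y)" for j
    unfolding dx_def d2 by (simp add: gauss_form_def inner_axis' power2_eq_square)
  have dyy: "dy j (dy j u) (x, y) = (- complex_of_real (2 * a) + (- complex_of_real (2 * a * y $ j)
      - \<i> * complex_of_real (\<tau> / 2 * x $ j))\<^sup>2) * u (x, y)" for j
    unfolding dy_def d2 by (simp add: gauss_form_def inner_axis' power2_eq_square)
  have termwise: "dx j (dx j u) (x, y) + dy j (dy j u) (x, y)
      + 2 * \<i> * complex_of_real \<tau> * (complex_of_real (y $ j) * dx j u (x, y))
      - complex_of_real (\<tau>\<^sup>2 * (y $ j * y $ j)) * u (x, y)
      = (- complex_of_real (4 * a)
         + complex_of_real (4 * (a\<^sup>2 - \<tau>\<^sup>2 / 16) * (x $ j * x $ j + y $ j * y $ j))) * u (x, y)" for j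
    unfolding dx dxx dyy
    by (simp add: algebra_simps power2_eq_square)
  have "laplacian_xy u (x, y)
       + 2 * \<i> * complex_of_real \<tau> * (\<Sum>j\<in>UNIV. complex_of_real (y $ j) * dx j u (x, y))
       - complex_of_real (\<tau>\<^sup>2 * (y \<bullet> y)) * u (x, y)
    = (\<Sum>j\<in>UNIV. dx j (dx j u) (x, y) + dy j (dy j u) (x, y)
      + 2 * \<i> * complex_of_real \<tau> * (complex_of_real (y $ j) * dx j u (x, y))
      - complex_of_real (\<tau>\<^sup>2 * (y $ j * y $ j)) * u (x, y))"
    by (simp add: laplacian_xy_def inner_vec_def sum.distrib sum_subtractf sum_distrib_left
        sum_distrib_right)
  also have "\<dots> = (- complex_of_real (4 * (real CARD('n) * a))
     + complex_of_real (4 * (a\<^sup>2 - \<tau>\<^sup>2 / 16) * (x \<bullet> x + y \<bullet> y))) * u (x, y)"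
    unfolding termwise
    by (simp add: inner_vec_def sum.distrib sum_subtractf sum_distrib_left[symmetric]
        sum_distrib_right[symmetric])
  finally have main: "laplacian_xy u (x, y)
       + 2 * \<i> * complex_of_real \<tau> * (\<Sum>j\<in>UNIV. complex_of_real (y $ j) * dx j u (x, y))
       - complex_of_real (\<tau>\<^sup>2 * (y \<bullet> y)) * u (x, y) =
      (- complex_of_real (4 * (real CARD('n) * a))
     + complex_of_real (4 * (a\<^sup>2 - \<tau>\<^sup>2 / 16) * (x \<bullet> x + y \<bullet> y))) * u (x, y)" .
  have "L_op \<gamma> \<tau> u (x, y) = - (1 / 4) * (laplacian_xy u (x, y)
       + 2 * \<i> * complex_of_real \<tau> * (\<Sum>j\<in>UNIV. complex_of_real (y $ j) * dx j u (x, y))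
       - complex_of_real (\<tau>\<^sup>2 * (y \<bullet> y)) * u (x, y) - \<gamma> * complex_of_real \<tau> * u (x, y))"
    by (simp add: L_op_def algebra_simps)
  also have "\<dots> = (\<gamma> * complex_of_real \<tau> / 4 + complex_of_real (real CARD('n) * a)
      - complex_of_real ((a\<^sup>2 - \<tau>\<^sup>2 / 16) * ((norm x)\<^sup>2 + (norm y)\<^sup>2))) * u (x, y)"
    unfolding main by (simp add: power2_norm_eq_inner field_simps)
  finally show ?thesis .
qed

text \<open>The factor \<open>n h / g\<close> is the logarithmic derivative of \<open>(\<pi> g)\<^sup>n\<close>, as \<open>g' = h\<close>.\<close>

lemma mehler_const_deriv:
  assumes "s > 0"
  shows "(mehler_const \<gamma> \<tau> n has_vector_derivative
    (- \<gamma> * complex_of_real \<tau> / 4 - complex_of_real (real n * (mehler_h \<tau> s / mehler_g \<tau> s)))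
      * mehler_const \<gamma> \<tau> n s) (at s)"
proof -
  have g: "mehler_g \<tau> s > 0"
    using assms by (rule mehler_g_pos)
  have E: "((\<lambda>r. exp (- \<gamma> * complex_of_real (r * \<tau>) / 4)) has_vector_derivative
     (- \<gamma> * complex_of_real \<tau> / 4) * exp (- \<gamma> * complex_of_real (s * \<tau>) / 4)) (at s)"
  proof -
    have "((\<lambda>r. complex_of_real (r * \<tau>)) has_vector_derivative complex_of_real \<tau>) (at s)"
      by (intro has_vector_derivative_of_real) (auto intro!: derivative_eq_intros)
    from has_vector_derivative_mult_right[OF this, of "- \<gamma> / 4"]
    have "((\<lambda>r. - \<gamma> * complex_of_real (r * \<tau>) / 4) has_vector_derivative
        - \<gamma> * complex_of_real \<tau> / 4) (at s)"
      by simp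
    from field_vector_diff_chain_at[OF this DERIV_exp] show ?thesis
      unfolding o_def .
  qed
  have "((\<lambda>r. (pi * mehler_g \<tau> r) ^ n) has_real_derivative
      real n * (mehler_h \<tau> s / mehler_g \<tau> s) * (pi * mehler_g \<tau> s) ^ n) (at s)"
    by (rule DERIV_cong[OF DERIV_power[OF DERIV_cmult[OF mehler_g_deriv, of pi]]])
      (use g in \<open>cases n; simp\<close>)
  note deriv_power = this
  have inverse_cancel: "- (d * q * inverse (q ^ Suc (Suc 0))) = - d * inverse q" if "q \<noteq> 0" for d q :: real
    using that by simp
  have "((\<lambda>r. inverse ((pi * mehler_g \<tau> r) ^ n)) has_real_derivative
      - (real n * (mehler_h \<tau> s / mehler_g \<tau> s)) * inverse ((pi * mehler_g \<tau> s) ^ n)) (at s)"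
    by (rule DERIV_cong[OF DERIV_inverse_fun[OF deriv_power] inverse_cancel]) (use g in simp_all)
  note product = has_vector_derivative_mult[OF E has_vector_derivative_of_real[OF this]]
  have const: "mehler_const \<gamma> \<tau> n = (\<lambda>r. exp (- \<gamma> * complex_of_real (r * \<tau>) / 4)
      * complex_of_real (inverse ((pi * mehler_g \<tau> r) ^ n)))"
    by (rule ext) (simp only: mehler_const_def divide_inverse of_real_inverse)
  have rearrange: "e * complex_of_real (- \<rho> * q) + \<kappa> * e * complex_of_real q
      = (\<kappa> - complex_of_real \<rho>) * (e * complex_of_real q)" for e \<kappa> \<rho> q
    by (simp add: algebra_simps)
  show ?thesis
    unfolding const using product unfolding rearrange .
qed

lemma rho_time_deriv:
  fixes x y :: "real ^ 'n::finite"
  assumes s: "s > 0"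
  shows "((\<lambda>r. rho \<gamma> \<tau> r (x, y)) has_vector_derivative
    (- \<gamma> * complex_of_real \<tau> / 4
       - complex_of_real (real CARD('n) * (mehler_h \<tau> s / mehler_g \<tau> s))
       + complex_of_real (((norm x)\<^sup>2 + (norm y)\<^sup>2) / (mehler_g \<tau> s)\<^sup>2)) * rho \<gamma> \<tau> s (x, y)) (at s)"
proof -
  let ?a = "\<lambda>r. mehler_h \<tau> r / mehler_g \<tau> r"
  let ?N = "(norm x)\<^sup>2 + (norm y)\<^sup>2"
  let ?E = "\<lambda>r. exp (gauss_form (?a r) (\<tau> / 2) (x, y) (x, y) / 2)"
  have "((\<lambda>r. complex_of_real (?a r * ?N)) has_vector_derivative
      complex_of_real (- (1 / (mehler_g \<tau> s)\<^sup>2) * ?N)) (at s)"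
    by (intro has_vector_derivative_of_real DERIV_cmult_right mehler_width_deriv s
        has_real_derivative_iff_has_vector_derivative[THEN iffD1])
  then have "((\<lambda>r. gauss_form (?a r) (\<tau> / 2) (x, y) (x, y) / 2) has_vector_derivative
      complex_of_real (?N / (mehler_g \<tau> s)\<^sup>2)) (at s)"
    unfolding gauss_form_diag by (auto intro!: derivative_eq_intros)
  then have "(?E has_vector_derivative complex_of_real (?N / (mehler_g \<tau> s)\<^sup>2) * ?E s) (at s)"
    using field_vector_diff_chain_at[OF _ DERIV_exp] unfolding o_def by blast
  note product = has_vector_derivative_mult[OF mehler_const_deriv[OF s, of \<gamma> \<tau> "CARD('n)"] this]
  have factor: "c * (\<kappa> * e) + \<mu> * c * e = (\<mu> + \<kappa>) * (c * e)" for c e \<kappa> \<mu> :: complex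
    by (simp add: algebra_simps)
  have "((\<lambda>r. mehler_const \<gamma> \<tau> CARD('n) r * ?E r) has_vector_derivative
    (- \<gamma> * complex_of_real \<tau> / 4
       - complex_of_real (real CARD('n) * (mehler_h \<tau> s / mehler_g \<tau> s))
       + complex_of_real (?N / (mehler_g \<tau> s)\<^sup>2)) * rho \<gamma> \<tau> s (x, y)) (at s)"
    unfolding rho_closed_form[OF s] using product unfolding factor .
  \<comment> \<open>The closed form holds only for positive times, which suffices since they form an open set.\<close>
  then show ?thesis
  proof (rule has_vector_derivative_transform_within_open)
    show "open {0::real<..}" "s \<in> {0<..}"
      using s by auto
    show "mehler_const \<gamma> \<tau> CARD('n) r * ?E r = rho \<gamma> \<tau> r (x, y)" if "r \<in> {0<..}" for r
      using that rho_closed_form[of r \<gamma> \<tau>, where 'n = 'n] by simp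
  qed
qed

text \<open>
  The time derivative and the operator each multiply the kernel by a factor. The terms of these
  factors in \<open>\<gamma>\<close> and \<open>n\<close> cancel directly, the quadratic ones by
  \<open>(h / g)\<^sup>2 - \<tau>\<^sup>2 / 16 = 1 / g\<^sup>2\<close>.
\<close>

lemma rho_heat_equation:
  fixes z :: "(real ^ 'n::finite) \<times> (real ^ 'n)"
  assumes s: "s > 0"
  shows "vector_derivative (\<lambda>r. rho \<gamma> \<tau> r z) (at s) + L_op \<gamma> \<tau> (rho \<gamma> \<tau> s) z = 0"
proof -
  obtain x y where z: "z = (x, y)"
    by (cases z)
  have "mehler_g \<tau> s > 0"
    using s by (rule mehler_g_pos)
  then have "(mehler_h \<tau> s / mehler_g \<tau> s)\<^sup>2 - \<tau>\<^sup>2 / 16 = 1 / (mehler_g \<tau> s)\<^sup>2"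
    by (simp add: power_divide mehler_pythagoras field_simps)
  then have "L_op \<gamma> \<tau> (rho \<gamma> \<tau> s) z = (\<gamma> * complex_of_real \<tau> / 4
       + complex_of_real (real CARD('n) * (mehler_h \<tau> s / mehler_g \<tau> s))
       - complex_of_real (((norm x)\<^sup>2 + (norm y)\<^sup>2) / (mehler_g \<tau> s)\<^sup>2)) * rho \<gamma> \<tau> s (x, y)"
    unfolding rho_closed_form[OF s] z L_op_gaussian by simp
  then show ?thesis
    unfolding z vector_derivative_at[OF rho_time_deriv[OF s]]
    by (simp only: distrib_right[symmetric]) simp
qed

section \<open>The initial value\<close>

lemma test_function_bounded:
  assumes "test_function \<phi>"
  obtains K where "\<And>z. norm (\<phi> z) \<le> K"
proof -
  define S where "S = closure {z. \<phi> z \<noteq> 0}"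
  have support: "compact S"
    using assms by (simp add: test_function_def S_def)
  have "Ck 0 \<phi>"
    using assms unfolding test_function_def by blast
  then have "continuous_on UNIV \<phi>"
    by simp
  then have "continuous_on S \<phi>"
    by (rule continuous_on_subset) simp
  then have "bounded (\<phi> ` S)"
    by (rule compact_imp_bounded[OF compact_continuous_image[OF _ support]])
  then obtain K where K: "\<forall>w\<in>\<phi> ` S. norm w \<le> K"
    unfolding bounded_iff ..
  have "norm (\<phi> z) \<le> max K 0" for z
  proof (cases "\<phi> z = 0")
    case False
    then have "z \<in> S"
      unfolding S_def by (intro subsetD[OF closure_subset]) simp
    then have "norm (\<phi> z) \<le> K"
      using K by simp
    then show ?thesis
      by simp
  qed simp
  then show ?thesis
    by (rule that)
qed

text \<open>
  Substituting \<open>z = c w\<close> with \<open>c = sqrt (g / h)\<close> turns the pairing with \<open>\<phi>\<close> into \<open>k s * G (c s)\<close>: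
  \<open>G\<close> is a Gaussian mean of \<open>f\<close>, the test function times the time-independent phase, and the
  powers of \<open>g\<close> in the prefactor and in the Jacobian \<open>c\<^sup>2\<^sup>n\<close> cancel, so that \<open>k\<close> is continuous at
  \<open>s = 0\<close>. The limits \<open>\<pi>\<^sup>n \<phi> 0\<close> of \<open>G\<close> and \<open>1 / \<pi>\<^sup>n\<close> of \<open>k\<close> multiply to \<open>\<phi> 0\<close>.
\<close>

lemma rho_tendsto_delta:
  "tendsto_distr (\<lambda>s. regular_distr (rho \<gamma> \<tau> s :: (real ^ 'n::finite) \<times> (real ^ 'n) \<Rightarrow> complex))
     (dirac_delta 0) (at_right 0)"
  unfolding tendsto_distr_def regular_distr_def dirac_delta_def
proof (intro allI impI)
  fix \<phi> :: "(real ^ 'n) \<times> (real ^ 'n) \<Rightarrow> complex"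
  assume test: "test_function \<phi>"
  define f where "f z = exp (- (\<i> * complex_of_real (\<tau> / 2 * (fst z \<bullet> snd z)))) * \<phi> z" for z
  define c where "c s = sqrt (mehler_g \<tau> s / mehler_h \<tau> s)" for s
  define G where "G = (\<lambda>c. LINT w|lborel. complex_of_real (exp (- (norm w)\<^sup>2)) * f (c *\<^sub>R w))"
  define k where "k s = exp (- \<gamma> * complex_of_real (s * \<tau>) / 4)
    / complex_of_real ((pi * mehler_h \<tau> s) ^ CARD('n))" for s
  obtain K where K: "\<And>z. norm (\<phi> z) \<le> K"
    using test_function_bounded[OF test] by blast
  have "Ck 0 \<phi>"
    using test by (auto simp: test_function_def)
  then have f_cont: "continuous_on UNIV f"
    unfolding f_def by (intro continuous_intros) auto
  then have f_meas: "f \<in> borel_measurable borel"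
    by (rule borel_measurable_continuous_onI)
  have f_bdd: "norm (f z) \<le> K" for z
    using K by (simp add: f_def norm_mult)
  have dim: "DIM((real ^ 'n) \<times> (real ^ 'n)) = 2 * CARD('n)"
    by simp
  have G_lim: "(G \<longlongrightarrow> complex_of_real (pi ^ CARD('n)) * \<phi> 0) (at 0)"
  proof -
    have "sqrt pi ^ DIM((real ^ 'n) \<times> (real ^ 'n)) = pi ^ CARD('n)"
      by (simp add: dim power_mult del: DIM_prod)
    moreover have "f 0 = \<phi> 0"
      by (simp add: f_def)
    ultimately show ?thesis
      using gaussian_mean_tendsto[OF f_cont f_bdd] unfolding G_def by metis
  qed
  have g_cont: "isCont (mehler_g \<tau>) 0" and h_cont: "isCont (mehler_h \<tau>) 0"
    using mehler_g_deriv mehler_h_deriv DERIV_isCont by blast+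
  have h0: "mehler_h \<tau> 0 = 1" and g0: "mehler_g \<tau> 0 = 0"
    by (simp_all add: mehler_h_def mehler_g_def)
  have pos: "eventually (\<lambda>s::real. s > 0) (at_right 0)"
    by (simp add: eventually_at_right_less)
  have c_pos: "c s > 0" if "s > 0" for s
    using that mehler_g_pos mehler_h_pos by (simp add: c_def)
  have "isCont c 0"
    unfolding c_def by (intro continuous_intros g_cont h_cont) (simp add: h0)
  then have "(c \<longlongrightarrow> 0) (at_right 0)"
    by (simp add: isCont_def c_def g0 filterlim_at_split)
  moreover have "eventually (\<lambda>s. c s \<noteq> 0) (at_right 0)"
    by (rule eventually_mono[OF pos]) (metis c_pos less_irrefl)
  ultimately have c_lim: "filterlim c (at 0) (at_right 0)"
    by (simp add: filterlim_at)
  have "isCont k 0"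
    unfolding k_def by (intro continuous_intros h_cont) (simp_all add: h0)
  moreover have "k 0 = 1 / complex_of_real (pi ^ CARD('n))"
    by (simp add: k_def h0)
  ultimately have k_lim: "(k \<longlongrightarrow> 1 / complex_of_real (pi ^ CARD('n))) (at_right 0)"
    unfolding isCont_def filterlim_at_split by simp
  have "(LINT z|lborel. rho \<gamma> \<tau> s z * \<phi> z) = k s * G (c s)" if s: "s > 0" for s
  proof -
    have g: "mehler_g \<tau> s > 0" and h: "mehler_h \<tau> s > 0"
      using s mehler_g_pos mehler_h_pos by auto
    have c2: "(c s)\<^sup>2 = mehler_g \<tau> s / mehler_h \<tau> s"
      using g h by (simp add: c_def)
    have gaussian: "exp (gauss_form (mehler_h \<tau> s / mehler_g \<tau> s) (\<tau> / 2) z z / 2)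
       = complex_of_real (exp (- (norm z)\<^sup>2 / (c s)\<^sup>2))
         * exp (- (\<i> * complex_of_real (\<tau> / 2 * (fst z \<bullet> snd z))))" for z :: "(real ^ 'n) \<times> (real ^ 'n)"
    proof (cases z)
      case (Pair x y)
      have width: "(norm (x, y))\<^sup>2 / (c s)\<^sup>2 = mehler_h \<tau> s / mehler_g \<tau> s * ((norm x)\<^sup>2 + (norm y)\<^sup>2)"
        by (simp add: c2 norm_Pair)
      have split: "exp (- complex_of_real p - q) = complex_of_real (exp (- p)) * exp (- q)" for p q
        unfolding exp_of_real[symmetric] mult_exp_exp by simp
      show ?thesis
        unfolding Pair gauss_form_diag split minus_divide_left[symmetric] width by simp
    qed
    have "rho \<gamma> \<tau> s z * \<phi> z = mehler_const \<gamma> \<tau> CARD('n) s *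
        (complex_of_real (exp (- (norm z)\<^sup>2 / (c s)\<^sup>2)) * f z)" for z
      unfolding rho_closed_form[OF s] f_def gaussian by (simp only: mult.assoc)
    then have "(LINT z|lborel. rho \<gamma> \<tau> s z * \<phi> z) = mehler_const \<gamma> \<tau> CARD('n) s *
       (LINT z|lborel. complex_of_real (exp (- (norm z)\<^sup>2 / (c s)\<^sup>2)) * f z)"
      by (simp only: integral_mult_right_zero)
    also have "\<dots> = mehler_const \<gamma> \<tau> CARD('n) s *
        complex_of_real ((c s) ^ (2 * CARD('n))) * G (c s)"
      unfolding gaussian_integral_rescale[OF f_meas c_pos[OF s]] G_def dim by (simp only: mult.assoc)
    also have "mehler_const \<gamma> \<tau> CARD('n) s * complex_of_real ((c s) ^ (2 * CARD('n))) = k s"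
    proof -
      have cancel: "e / complex_of_real (p * q) * complex_of_real (q / r) = e / complex_of_real (p * r)"
        if "q \<noteq> 0" for e p q r
        using that by simp
      show ?thesis
        unfolding power_mult c2 mehler_const_def k_def power_mult_distrib power_divide
        by (rule cancel) (use g in simp)
    qed
    finally show ?thesis .
  qed
  then have "eventually (\<lambda>s. k s * G (c s) = (LINT z|lborel. rho \<gamma> \<tau> s z * \<phi> z)) (at_right 0)"
    using pos by (auto elim: eventually_mono)
  moreover have "((\<lambda>s. k s * G (c s)) \<longlongrightarrow>
      1 / complex_of_real (pi ^ CARD('n)) * (complex_of_real (pi ^ CARD('n)) * \<phi> 0)) (at_right 0)"
    by (intro tendsto_mult k_lim filterlim_compose[OF G_lim c_lim])
  ultimately show "((\<lambda>s. LINT z|lborel. rho \<gamma> \<tau> s z * \<phi> z) \<longlongrightarrow> \<phi> 0) (at_right 0)"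
    by (rule Lim_transform_eventually[rotated, THEN tendsto_eq_rhs]) simp
qed

theorem corollary1p3:
  fixes \<gamma> :: complex and \<tau> :: real
  shows "fundamental_solution
    (L_op \<gamma> \<tau> :: ((real ^ 'n::finite) \<times> (real ^ 'n) \<Rightarrow> complex) \<Rightarrow> (real ^ 'n) \<times> (real ^ 'n) \<Rightarrow> complex)
    (rho \<gamma> \<tau>)"
proof -
  let ?rho = "rho \<gamma> \<tau> :: real \<Rightarrow> (real ^ 'n) \<times> (real ^ 'n) \<Rightarrow> complex"
  have smooth: "Ck 2 (?rho s)" if "s > 0" for s
    unfolding rho_closed_form[OF that]
    by (rule Ck_2_exp_quadratic[OF bounded_bilinear_gauss_form gauss_form_commute])
  have "(\<lambda>r. ?rho r z) differentiable (at s)" if "s > 0" for s z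
    using rho_time_deriv[OF that] by (cases z) (blast intro: differentiableI_vector)
  moreover have "locally_integrable (?rho s)" if "s > 0" for s
  proof -
    have "continuous_on UNIV (?rho s)"
      using smooth[OF that] by (simp add: numeral_2_eq_2 differentiable_imp_continuous_on)
    then show ?thesis
      unfolding locally_integrable_def set_integrable_def
      using continuous_on_subset borel_integrable_compact by (metis subset_UNIV)
  qed
  ultimately show ?thesis
    unfolding fundamental_solution_def
    using smooth rho_heat_equation rho_tendsto_delta by blast
qed

end
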